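(* Let $\mathbf{X}_1,\dots,\mathbf{X}_p$ be independent $n$-dimensional random vectors with a common spherical distribution satisfying $P(\mathbf{X}_1=\mathbf{0})=0$, and let $\rho_{ij}$ be the Pearson correlation coefficient of $\mathbf{X}_i$ and $\mathbf{X}_j$. Then the following holds for all $1\le i<j\le p$. (i) When $n=2$, $\rho_{ij}$ has the symmetric Bernoulli distribution, i.e., $P(\rho_{ij}=1)=P(\rho_{ij}=-1)=1/2$. (ii) When $n=3$, $\rho_{ij}$ has the density $f(\rho)=\frac1\pi\frac{1}{\sqrt{1-\rho^2}}$ on $(-1,1)$. That is, $\rho_{ij}^2$ follows the arcsine law on $[0,1]$. (iii) When $n=4$, $\rho_{ij}$ follows the uniform distribution on $[-1,1]$. (iv) When $n=5$, $\rho_{ij}$ has the density $f(\rho)=\frac2\pi\sqrt{1-\rho^2}$ for $|\rho|\le1$. That is, $\rho_{ij}$ follows the semi-circle law.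
   Context: A random vector $\mathbf{Y}\in\mathbb{R}^n$ has a spherical distribution if $\mathbf{O}\mathbf{Y}$ and $\mathbf{Y}$ have the same probability distribution for every $n\times n$ orthogonal matrix $\mathbf{O}$. For $\mathbf{x}=(x_1,\dots,x_n)^T$, $\mathbf{y}=(y_1,\dots,y_n)^T\in\mathbb{R}^n$, the Pearson correlation coefficient is $$\rho_{\mathbf{x},\mathbf{y}}=\frac{\sum_{i=1}^n(x_i-\bar x)(y_i-\bar y)}{\sqrt{\sum_{i=1}^n(x_i-\bar x)^2\cdot\sum_{i=1}^n(y_i-\bar y)^2}},\qquad \bar x=\frac1n\sum_{i=1}^n x_i,\quad \bar y=\frac1n\sum_{i=1}^n y_i,$$ and $\rho_{ij}=\rho_{\mathbf{X}_i,\mathbf{X}_j}$ (almost surely well defined for $n\ge2$). The arcsine law on $[0,1]$ is the distribution with density $\frac{1}{\pi\sqrt{x(1-x)}}$ on $(0,1)$. *)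

theory Defs
  imports "HOL-Probability.Probability"
begin

text \<open>Vectors in \<open>\<real>\<^sup>n\<close> are rendered as \<open>real ^ 'n\<close>, the dimension being \<open>CARD('n)\<close>.\<close>

definition spherical_vector :: "'a measure \<Rightarrow> ('a \<Rightarrow> real ^ 'n) \<Rightarrow> bool" where
  "spherical_vector M Y \<longleftrightarrow>
     Y \<in> borel_measurable M \<and>
     (\<forall>Q :: real ^ 'n ^ 'n. orthogonal_matrix Q \<longrightarrow>
        distr M borel (\<lambda>\<omega>. Q *v Y \<omega>) = distr M borel Y)"

definition vec_mean :: "real ^ 'n \<Rightarrow> real" where
  "vec_mean x = (\<Sum>i\<in>UNIV. x $ i) / real CARD('n)"

text \<open>If \<open>x\<close> or \<open>y\<close> has all coordinates equal, the denominator vanishes and the value is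
  \<open>0\<close> by the convention for division.\<close>

definition pearson_correlation :: "real ^ 'n \<Rightarrow> real ^ 'n \<Rightarrow> real" where
  "pearson_correlation x y =
     (\<Sum>i\<in>UNIV. (x $ i - vec_mean x) * (y $ i - vec_mean y)) /
     sqrt ((\<Sum>i\<in>UNIV. (x $ i - vec_mean x)\<^sup>2) * (\<Sum>i\<in>UNIV. (y $ i - vec_mean y)\<^sup>2))"

definition arcsine_density :: "real \<Rightarrow> real" where
  "arcsine_density x = (if 0 < x \<and> x < 1 then 1 / (pi * sqrt (x * (1 - x))) else 0)"

definition semicircle_density :: "real \<Rightarrow> real \<Rightarrow> real" where
  "semicircle_density R x = (if \<bar>x\<bar> \<le> R then 2 / (pi * R\<^sup>2) * sqrt (R\<^sup>2 - x\<^sup>2) else 0)"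

end

theory Submission
  imports Defs
begin

text \<open>The correlation of \<open>x\<close> and \<open>y\<close> is the cosine of the angle between their projections onto the
  hyperplane orthogonal to \<open>(1, \<dots>, 1)\<close>. An isometry \<open>\<real>\<^sup>n \<rightarrow> \<real> \<times> E\<close> that sends \<open>(1, \<dots>, 1)\<close> to the
  first axis turns the projection into \<open>snd\<close>, and it carries spherical laws to rotation-invariant
  laws on \<open>E\<close>, a Euclidean space of dimension \<open>n - 1\<close>. The question is therefore the law of the
  cosine of two independent rotation-invariant vectors in \<open>E\<close>.

  This law does not depend on the two vectors. If one is held fixed, the cosine with the
  other has a law that is the same for every nonzero fixed vector, by invariance; averaging in both
  orders, by Fubini, shows that the cosine with a fixed vector has the same law under
  \<^emph>\<open>any\<close> two rotation-invariant laws without mass at the origin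
  (\<open>nn_integral_cosine_universal\<close>). One may compute with the uniform law on the unit ball, whose
  invariance is that of Lebesgue measure. The same principle shows that a spherical vector is almost
  surely not a multiple of \<open>(1, \<dots>, 1)\<close>, so that the projections do not vanish.

  For the ball in \<open>E = \<real> \<times> V\<close>, \<open>d = dim V\<close>, take the pole \<open>(1, 0)\<close> as fixed vector. The cosine of \<open>(a, v)\<close>
  is \<open>s / sqrt (1 + s\<^sup>2)\<close> for the slope \<open>s = a / norm v\<close>. Integrating over \<open>s\<close> in place of \<open>a\<close> and then
  rescaling \<open>v\<close> by \<open>sqrt (1 + s\<^sup>2)\<close> shows that the slope has a density proportional to
  \<open>(1 + s\<^sup>2) powr (-(d + 1) / 2)\<close>, hence the cosine one proportional to
  \<open>(1 - t\<^sup>2) powr ((d - 2) / 2)\<close> on \<open>(-1, 1)\<close>, where \<open>d = n - 2\<close> (\<open>nn_integral_ball_cosine_pole\<close>). The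
  constant follows from the total mass. The exponents \<open>-1/2\<close>, \<open>0\<close> and \<open>1/2\<close> for \<open>n = 3, 4, 5\<close> give the
  densities of the theorem, and for \<open>n = 2\<close> the space \<open>E\<close> is a line on which the cosine is a sign.\<close>

section \<open>Orthogonal maps and Lebesgue measure\<close>

lemma orthogonal_transformation_exists_euclidean:
  fixes a b :: "'e::real_inner"
  assumes "norm a = norm b"
  obtains Q :: "'e \<Rightarrow> 'e" where "orthogonal_transformation Q" "Q a = b"
proof -
  \<comment> \<open>The reflection in the hyperplane orthogonal to \<open>a - b\<close>; it is the identity when \<open>a = b\<close>, by division by zero.\<close>
  define w where "w = a - b"
  define Q where "Q = (\<lambda>z. z - (2 * (w \<bullet> z) / (w \<bullet> w)) *\<^sub>R w)"
  have lin: "linear Q"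
    by (auto simp: Q_def linear_iff inner_add_right algebra_simps add_divide_distrib)
  have inn: "Q x \<bullet> Q y = x \<bullet> y" for x y
  proof (cases "w = 0")
    case False
    then have "w \<bullet> w \<noteq> 0" by simp
    then show ?thesis
      unfolding Q_def by (simp add: inner_diff_left inner_diff_right inner_commute[of x w] field_simps)
  qed (simp add: Q_def)
  have ot: "orthogonal_transformation Q"
    using lin inn by (simp add: orthogonal_transformation_def)
  have "a \<bullet> a = b \<bullet> b"
    using assms by (simp add: dot_square_norm)
  then have ww: "w \<bullet> w = 2 * (w \<bullet> a)"
    by (simp add: w_def inner_diff_left inner_diff_right inner_commute)
  have "Q a = b"
  proof (cases "w = 0")
    case False
    then have "w \<bullet> w \<noteq> 0" by simp
    then have "2 * (w \<bullet> a) / (w \<bullet> w) = 1"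
      unfolding ww[symmetric] by (rule divide_self)
    then have "Q a = a - w" by (simp only: Q_def scaleR_one)
    then show ?thesis by (simp add: w_def)
  qed (use w_def Q_def in simp)
  with ot show thesis by (rule that)
qed

lemma nn_integral_lborel_translate:
  fixes f :: "'e::euclidean_space \<Rightarrow> ennreal"
  assumes [measurable]: "f \<in> borel_measurable borel"
  shows "(\<integral>\<^sup>+x. f (c + x) \<partial>lborel) = (\<integral>\<^sup>+x. f x \<partial>lborel)"
  by (subst lborel_distr_plus[of c, symmetric]) (simp add: nn_integral_distr)

lemma borel_measurable_orthogonal_transformation:
  fixes Q :: "'a::euclidean_space \<Rightarrow> 'b::euclidean_space"
  assumes "orthogonal_transformation Q"
  shows "Q \<in> borel_measurable borel"
  using assms
  by (intro borel_measurable_continuous_onI linear_continuous_on)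
     (simp add: orthogonal_transformation_def linear_conv_bounded_linear[symmetric])

text \<open>The uniqueness argument for Haar measure, in a special case. The image measure \<open>\<mu>\<close> under \<open>Q\<close> is
  translation invariant because \<open>Q\<close> is onto. For a set \<open>A\<close> and the unit ball \<open>B\<close>, Fubini and the invariance
  of both measures turn \<open>\<mu>(A) vol(B)\<close> into \<open>vol(A) \<mu>(B)\<close>; and \<open>\<mu>(B) = vol(B)\<close> since \<open>Q\<close> preserves the norm.\<close>

lemma lborel_distr_orthogonal_transformation:
  fixes Q :: "'e::euclidean_space \<Rightarrow> 'e"
  assumes Q: "orthogonal_transformation Q"
  shows "distr lborel borel Q = lborel"
proof (rule measure_eqI)
  fix A assume "A \<in> sets (distr lborel borel Q)"
  then have [measurable]: "A \<in> sets borel" by simp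
  have [measurable]: "Q \<in> borel_measurable borel"
    by (rule borel_measurable_orthogonal_transformation[OF Q])
  have lin: "linear Q" and normQ: "norm (Q x) = norm x" for x
    using Q by (auto simp: orthogonal_transformation)
  have surjQ: "surj Q"
    using Q by (rule orthogonal_transformation_surj)
  \<comment> \<open>The ball is preserved by \<open>Q\<close>, symmetric, and of positive finite volume, so its volume cancels in the end.\<close>
  define B where "B = ball (0::'e) 1"
  have [measurable]: "B \<in> sets borel" by (simp add: B_def)
  have inner1: "(\<integral>\<^sup>+x. indicator A (Q x + y) \<partial>lborel) = (\<integral>\<^sup>+x. indicator A (Q x) \<partial>lborel)" for y
  proof -
    obtain c where "y = Q c" using surjQ by (auto simp: surj_def)
    then have "(\<integral>\<^sup>+x. indicator A (Q x + y) \<partial>lborel) = (\<integral>\<^sup>+x. indicator A (Q (c + x)) \<partial>lborel)"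
      using lin by (simp add: linear_add add.commute)
    also have "\<dots> = (\<integral>\<^sup>+x. indicator A (Q x) \<partial>lborel)"
      by (rule nn_integral_lborel_translate[of "\<lambda>x. indicator A (Q x)"]) measurable
    finally show ?thesis .
  qed
  have inner2: "(\<integral>\<^sup>+x. indicator B (y - Q x) \<partial>lborel) = emeasure lborel B" for y
  proof -
    obtain c where c: "y = Q c" using surjQ by (auto simp: surj_def)
    have "indicator B (y - Q x) = (indicator B (- c + x) :: ennreal)" for x
    proof -
      have "norm (y - Q x) = norm (c - x)"
        using normQ[of "c - x"] lin by (simp add: c linear_diff)
      then show ?thesis
        by (simp add: B_def indicator_def norm_minus_commute)
    qed
    then show ?thesis
      using nn_integral_lborel_translate[of "indicator B" "- c"] by (simp add: fun_eq_iff)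
  qed
  have "emeasure (distr lborel borel Q) A * emeasure lborel B
        = (\<integral>\<^sup>+y. indicator B y * (\<integral>\<^sup>+x. indicator A (Q x) \<partial>lborel) \<partial>lborel)"
    by (simp add: nn_integral_multc nn_integral_distr mult.commute flip: nn_integral_indicator)
  also have "\<dots> = (\<integral>\<^sup>+y. \<integral>\<^sup>+x. indicator B y * indicator A (Q x + y) \<partial>lborel \<partial>lborel)"
    by (simp add: inner1 nn_integral_cmult)
  also have "\<dots> = (\<integral>\<^sup>+x. \<integral>\<^sup>+y. indicator B y * indicator A (Q x + y) \<partial>lborel \<partial>lborel)"
    by (rule lborel_pair.Fubini') measurable
  also have "\<dots> = (\<integral>\<^sup>+x. \<integral>\<^sup>+y. indicator B (y - Q x) * indicator A y \<partial>lborel \<partial>lborel)"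
  proof (rule nn_integral_cong)
    fix x :: 'e
    show "(\<integral>\<^sup>+y. indicator B y * indicator A (Q x + y) \<partial>lborel)
        = (\<integral>\<^sup>+y. indicator B (y - Q x) * indicator A y \<partial>lborel)"
      using nn_integral_lborel_translate[of "\<lambda>y. indicator B (y - Q x) * indicator A y" "Q x"]
      by simp
  qed
  also have "\<dots> = (\<integral>\<^sup>+y. \<integral>\<^sup>+x. indicator B (y - Q x) * indicator A y \<partial>lborel \<partial>lborel)"
    by (rule lborel_pair.Fubini') measurable
  also have "\<dots> = emeasure lborel A * emeasure lborel B"
    by (simp add: nn_integral_multc inner2 nn_integral_cmult mult.commute)
  finally have eq: "emeasure (distr lborel borel Q) A * emeasure lborel B
                    = emeasure lborel A * emeasure lborel B" .
  have "emeasure lborel B \<noteq> 0" "emeasure lborel B \<noteq> \<infinity>"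
    using emeasure_lborel_ball_finite[of "0::'e" 1] content_ball_pos[of 1 "0::'e"]
    by (auto simp: B_def emeasure_eq_ennreal_measure)
  with eq show "emeasure (distr lborel borel Q) A = emeasure lborel A"
    by (metis ennreal_mult_divide_eq infinity_ennreal_def)
qed simp

section \<open>The cosine under rotation-invariant laws\<close>

text \<open>The condition at the origin makes the direction of the random vector almost surely well defined.\<close>

definition isotropic :: "'e::euclidean_space measure \<Rightarrow> bool" where
  "isotropic \<mu> \<longleftrightarrow> prob_space \<mu> \<and> sets \<mu> = sets borel \<and>
     (\<forall>Q. orthogonal_transformation Q \<longrightarrow> distr \<mu> borel Q = \<mu>) \<and> (AE x in \<mu>. x \<noteq> 0)"

definition cosine :: "'e::real_inner \<Rightarrow> 'e \<Rightarrow> real" where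
  "cosine x y = (x \<bullet> y) / (norm x * norm y)"

lemma cosine_commute: "cosine x y = cosine y x"
  by (simp add: cosine_def inner_commute mult.commute)

lemma borel_measurable_cosine [measurable]:
  fixes f g :: "'a \<Rightarrow> 'e::euclidean_space"
  assumes [measurable]: "f \<in> borel_measurable M" "g \<in> borel_measurable M"
  shows "(\<lambda>x. cosine (f x) (g x)) \<in> borel_measurable M"
  unfolding cosine_def by measurable

lemma isotropic_uniform_ball:
  "isotropic (uniform_measure lborel (ball (0::'e::euclidean_space) 1))"
  unfolding isotropic_def
proof (intro conjI allI impI)
  let ?B = "ball (0::'e) 1"
  have B: "emeasure lborel ?B \<noteq> 0" "emeasure lborel ?B \<noteq> \<infinity>"
    using emeasure_lborel_ball_finite[of "0::'e" 1] content_ball_pos[of 1 "0::'e"]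
    by (auto simp: emeasure_eq_ennreal_measure)
  show "prob_space (uniform_measure lborel ?B)"
    using B by (rule prob_space_uniform_measure)
  show "sets (uniform_measure lborel ?B) = sets borel" by simp
  show "AE x in uniform_measure lborel ?B. x \<noteq> 0"
    using AE_lborel_singleton[of "0::'e"] by (intro AE_uniform_measureI) auto
  fix Q :: "'e \<Rightarrow> 'e" assume Q: "orthogonal_transformation Q"
  have [measurable]: "Q \<in> borel_measurable borel"
    by (rule borel_measurable_orthogonal_transformation[OF Q])
  show "distr (uniform_measure lborel ?B) borel Q = uniform_measure lborel ?B"
  proof (rule measure_eqI)
    fix A assume "A \<in> sets (distr (uniform_measure lborel ?B) borel Q)"
    then have [measurable]: "A \<in> sets borel" by simp
    have "?B \<inter> Q -` A = Q -` (?B \<inter> A)"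
      using Q by (auto simp: orthogonal_transformation)
    then have "emeasure lborel (?B \<inter> Q -` A) = emeasure (distr lborel borel Q) (?B \<inter> A)"
      by (simp add: emeasure_distr)
    also have "\<dots> = emeasure lborel (?B \<inter> A)"
      by (simp add: lborel_distr_orthogonal_transformation[OF Q])
    finally show "emeasure (distr (uniform_measure lborel ?B) borel Q) A
        = emeasure (uniform_measure lborel ?B) A"
      using measurable_sets_borel[of Q borel A] by (simp add: emeasure_distr)
  qed simp
qed

text \<open>Rotate the direction of \<open>x\<close> into that of \<open>y\<close>; the law of \<open>z\<close> is invariant under this rotation.\<close>

lemma nn_integral_cosine_direction:
  fixes \<mu> :: "'e::euclidean_space measure"
  assumes \<mu>: "isotropic \<mu>" and [measurable]: "f \<in> borel_measurable borel"
    and xy: "x \<noteq> 0" "y \<noteq> 0"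
  shows "(\<integral>\<^sup>+z. f (cosine x z) \<partial>\<mu>) = (\<integral>\<^sup>+z. f (cosine y z) \<partial>\<mu>)"
proof -
  have [measurable_cong]: "sets \<mu> = sets borel" using \<mu> by (simp add: isotropic_def)
  obtain Q where Q: "orthogonal_transformation Q" "Q (x /\<^sub>R norm x) = y /\<^sub>R norm y"
    using xy by (auto intro: orthogonal_transformation_exists_euclidean[of "x /\<^sub>R norm x" "y /\<^sub>R norm y"])
  have [measurable]: "Q \<in> borel_measurable borel"
    by (rule borel_measurable_orthogonal_transformation[OF Q(1)])
  have unit: "cosine v z = (v /\<^sub>R norm v) \<bullet> z / norm z" for v z :: 'e
    by (simp add: cosine_def field_simps)
  have "cosine y (Q z) = cosine x z" for z
    unfolding unit Q(2)[symmetric]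
    using Q(1) by (simp add: orthogonal_transformation_def norm_eq_sqrt_inner)
  moreover have "(\<integral>\<^sup>+z. f (cosine y z) \<partial>\<mu>) = (\<integral>\<^sup>+z. f (cosine y (Q z)) \<partial>\<mu>)"
  proof -
    have "distr \<mu> borel Q = \<mu>" using \<mu> Q by (simp add: isotropic_def)
    then have "(\<integral>\<^sup>+z. f (cosine y z) \<partial>\<mu>) = (\<integral>\<^sup>+z. f (cosine y z) \<partial>distr \<mu> borel Q)" by simp
    also have "\<dots> = (\<integral>\<^sup>+z. f (cosine y (Q z)) \<partial>\<mu>)"
      by (rule nn_integral_distr) measurable
    finally show ?thesis .
  qed
  ultimately show ?thesis by simp
qed

lemma nn_integral_cosine_pair:
  fixes \<mu> \<nu> :: "'e::euclidean_space measure"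
  assumes \<mu>: "isotropic \<mu>" and \<nu>: "isotropic \<nu>"
    and [measurable]: "f \<in> borel_measurable borel" and e: "e \<noteq> 0"
  shows "(\<integral>\<^sup>+x. \<integral>\<^sup>+y. f (cosine x y) \<partial>\<nu> \<partial>\<mu>) = (\<integral>\<^sup>+y. f (cosine e y) \<partial>\<nu>)"
proof -
  interpret \<mu>: prob_space \<mu> using \<mu> by (simp add: isotropic_def)
  have "AE x in \<mu>. x \<noteq> 0" using \<mu> by (simp add: isotropic_def)
  then have "(\<integral>\<^sup>+x. \<integral>\<^sup>+y. f (cosine x y) \<partial>\<nu> \<partial>\<mu>) = (\<integral>\<^sup>+x. \<integral>\<^sup>+y. f (cosine e y) \<partial>\<nu> \<partial>\<mu>)"
    by (intro nn_integral_cong_AE)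
       (auto elim!: eventually_mono intro!: nn_integral_cosine_direction[OF \<nu>] e)
  then show ?thesis by (simp add: \<mu>.emeasure_space_1)
qed

text \<open>Both sides equal the double integral over \<open>\<mu>\<close> and \<open>\<nu>\<close>, evaluated in the two orders. This is what
  allows a general law to be replaced by the uniform law on the ball.\<close>

lemma nn_integral_cosine_universal:
  fixes \<mu> \<nu> :: "'e::euclidean_space measure"
  assumes \<mu>: "isotropic \<mu>" and \<nu>: "isotropic \<nu>"
    and [measurable]: "f \<in> borel_measurable borel" and e: "e \<noteq> 0"
  shows "(\<integral>\<^sup>+y. f (cosine e y) \<partial>\<mu>) = (\<integral>\<^sup>+y. f (cosine e y) \<partial>\<nu>)"
proof -
  have [measurable_cong]: "sets \<mu> = sets borel" "sets \<nu> = sets borel"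
    using \<mu> \<nu> by (simp_all add: isotropic_def)
  interpret \<mu>: prob_space \<mu> using \<mu> by (simp add: isotropic_def)
  interpret \<nu>: prob_space \<nu> using \<nu> by (simp add: isotropic_def)
  interpret pair_sigma_finite \<nu> \<mu> ..
  have "(\<integral>\<^sup>+y. f (cosine e y) \<partial>\<mu>) = (\<integral>\<^sup>+x. \<integral>\<^sup>+y. f (cosine x y) \<partial>\<mu> \<partial>\<nu>)"
    using nn_integral_cosine_pair[OF \<nu> \<mu> _ e] by simp
  also have "\<dots> = (\<integral>\<^sup>+y. \<integral>\<^sup>+x. f (cosine x y) \<partial>\<nu> \<partial>\<mu>)"
    by (rule Fubini'[symmetric]) measurable
  also have "\<dots> = (\<integral>\<^sup>+y. \<integral>\<^sup>+x. f (cosine y x) \<partial>\<nu> \<partial>\<mu>)"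
    by (simp add: cosine_commute)
  also have "\<dots> = (\<integral>\<^sup>+y. f (cosine e y) \<partial>\<nu>)"
    using nn_integral_cosine_pair[OF \<mu> \<nu> _ e] by simp
  finally show ?thesis .
qed

section \<open>Images of rotation-invariant laws\<close>

text \<open>The image law inherits invariance as soon as every rotation of the target can be lifted along \<open>L\<close> to a
  rotation of the source.\<close>

lemma isotropic_distr:
  fixes \<mu> :: "'a::euclidean_space measure" and L :: "'a \<Rightarrow> 'b::euclidean_space"
  assumes \<mu>: "isotropic \<mu>" and [measurable]: "L \<in> borel_measurable borel"
    and lift: "\<And>R :: 'b \<Rightarrow> 'b. orthogonal_transformation R \<Longrightarrow>
                 \<exists>Q :: 'a \<Rightarrow> 'a. orthogonal_transformation Q \<and> (\<forall>x. R (L x) = L (Q x))"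
    and nz: "AE x in \<mu>. L x \<noteq> 0"
  shows "isotropic (distr \<mu> borel L)"
  unfolding isotropic_def
proof (intro conjI allI impI)
  have [measurable_cong]: "sets \<mu> = sets borel" using \<mu> by (simp add: isotropic_def)
  interpret prob_space \<mu> using \<mu> by (simp add: isotropic_def)
  show "prob_space (distr \<mu> borel L)" by (rule prob_space_distr) measurable
  show "AE x in distr \<mu> borel L. x \<noteq> 0"
    using nz by (subst AE_distr_iff) measurable
  fix R :: "'b \<Rightarrow> 'b" assume R: "orthogonal_transformation R"
  obtain Q where Q: "orthogonal_transformation Q" "\<And>x. R (L x) = L (Q x)"
    using lift[OF R] by blast
  have [measurable]: "R \<in> borel_measurable borel" "Q \<in> borel_measurable borel"
    using R Q(1) by (simp_all add: borel_measurable_orthogonal_transformation)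
  have "distr (distr \<mu> borel L) borel R = distr \<mu> borel (\<lambda>x. L (Q x))"
    by (simp add: distr_distr o_def Q(2))
  also have "\<dots> = distr (distr \<mu> borel Q) borel L"
    by (simp add: distr_distr o_def)
  also have "distr \<mu> borel Q = \<mu>" using \<mu> Q(1) by (simp add: isotropic_def)
  finally show "distr (distr \<mu> borel L) borel R = distr \<mu> borel L" .
qed simp

lemma isotropic_distr_isometry:
  fixes \<mu> :: "'a::euclidean_space measure" and L :: "'a \<Rightarrow> 'b::euclidean_space"
  assumes \<mu>: "isotropic \<mu>" and L: "orthogonal_transformation L" "orthogonal_transformation K"
    and inv: "\<And>y. L (K y) = y"
  shows "isotropic (distr \<mu> borel L)"
proof (rule isotropic_distr[OF \<mu>])
  show "L \<in> borel_measurable borel"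
    by (rule borel_measurable_orthogonal_transformation[OF L(1)])
  show "\<exists>Q :: 'a \<Rightarrow> 'a. orthogonal_transformation Q \<and> (\<forall>x. R (L x) = L (Q x))"
    if R: "orthogonal_transformation R" for R :: "'b \<Rightarrow> 'b"
    by (rule exI[of _ "K \<circ> (R \<circ> L)"])
       (simp add: inv L R orthogonal_transformation_compose)
  have "AE x in \<mu>. x \<noteq> 0" using \<mu> by (simp add: isotropic_def)
  then show "AE x in \<mu>. L x \<noteq> 0"
    by eventually_elim (metis L(1) norm_eq_zero orthogonal_transformation_norm)
qed

text \<open>A rotation of the second factor lifts by acting trivially on the first. The issue is the mass
  at the origin: it is the mass that \<open>\<mu>\<close> gives to the axis \<open>\<real> \<times> {0}\<close>, which is zero because being on the axis
  is a condition on the cosine with \<open>(1, 0)\<close>, and a line is a null set for Lebesgue measure.\<close>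

lemma isotropic_distr_snd:
  fixes \<mu> :: "(real \<times> 'e::euclidean_space) measure"
  assumes \<mu>: "isotropic \<mu>"
  shows "isotropic (distr \<mu> borel snd)"
proof (rule isotropic_distr[OF \<mu>])
  show "snd \<in> borel_measurable (borel :: (real \<times> 'e) measure)"
    by (intro borel_measurable_continuous_onI continuous_intros)
  show "\<exists>Q :: real \<times> 'e \<Rightarrow> real \<times> 'e. orthogonal_transformation Q \<and> (\<forall>x. R (snd x) = snd (Q x))"
    if R: "orthogonal_transformation R" for R :: "'e \<Rightarrow> 'e"
    by (rule exI[of _ "\<lambda>x. (fst x, R (snd x))"])
       (use R in \<open>auto simp: orthogonal_transformation_def inner_prod_def linear_iff\<close>)
  have [measurable_cong]: "sets \<mu> = sets borel" using \<mu> by (simp add: isotropic_def)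
  \<comment> \<open>On nonzero \<open>z\<close>, the second component vanishes exactly when the cosine with the pole \<open>e\<close> is \<open>1\<close> or \<open>-1\<close>,
    so the event may be measured under the uniform law on the ball instead of \<open>\<mu>\<close>.\<close>
  define B where "B = ball (0 :: real \<times> 'e) 1"
  define e :: "real \<times> 'e" where "e = (1, 0)"
  have e0: "e \<noteq> 0" by (simp add: e_def zero_prod_def)
  define f :: "real \<Rightarrow> ennreal" where "f = indicator {-1, 1}"
  have [measurable]: "f \<in> borel_measurable borel" by (simp add: f_def)
  have pole: "f (cosine e z) = indicator {z. snd z = 0} z" if "z \<noteq> 0" for z
  proof -
    have "cosine e z \<in> {-1, 1} \<longleftrightarrow> \<bar>fst z\<bar> = norm z"
    proof -
      have "cosine e z = fst z / norm z"
        by (simp add: e_def cosine_def inner_prod_def)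
      moreover have "cosine e z \<in> {-1, 1} \<longleftrightarrow> \<bar>cosine e z\<bar> = 1"
        by (auto simp: abs_if split: if_splits)
      ultimately have "cosine e z \<in> {-1, 1} \<longleftrightarrow> \<bar>fst z\<bar> / norm z = 1"
        by (simp only: abs_divide abs_norm_cancel)
      then show ?thesis using that by auto
    qed
    also have "\<dots> \<longleftrightarrow> (fst z)\<^sup>2 = (norm z)\<^sup>2"
      by (metis abs_norm_cancel power2_eq_iff_nonneg power2_abs abs_ge_zero norm_ge_zero)
    also have "\<dots> \<longleftrightarrow> snd z = 0"
      by (simp add: norm_prod_def)
    finally show ?thesis by (simp add: f_def indicator_def)
  qed
  have "{z :: real \<times> 'e. snd z \<noteq> 0} \<in> sets borel"
    by (intro borel_open open_Collect_neq continuous_intros)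
  then have "{z \<in> space (lborel \<Otimes>\<^sub>M lborel). snd z \<noteq> (0::'e)}
      \<in> sets (lborel \<Otimes>\<^sub>M lborel :: (real \<times> 'e) measure)"
    unfolding lborel_prod by simp
  then have "AE z in lborel \<Otimes>\<^sub>M lborel. snd (z :: real \<times> 'e) \<noteq> 0"
    by (rule lborel_pair.AE_pair_measure) (simp add: AE_lborel_singleton)
  then have snd0: "AE z in lborel. snd (z :: real \<times> 'e) \<noteq> 0"
    unfolding lborel_prod .
  have "(\<integral>\<^sup>+z. f (cosine e z) \<partial>\<mu>) = (\<integral>\<^sup>+z. f (cosine e z) \<partial>uniform_measure lborel B)"
    unfolding B_def by (rule nn_integral_cosine_universal[OF \<mu> isotropic_uniform_ball _ e0]) measurable
  also have "\<dots> = 0"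
  proof (subst nn_integral_0_iff_AE)
    show "AE z in uniform_measure lborel B. f (cosine e z) = 0"
    proof (rule AE_uniform_measureI)
      show "AE z in lborel. z \<in> B \<longrightarrow> f (cosine e z) = 0"
        using snd0
      proof eventually_elim
        case (elim z)
        then have "z \<noteq> 0" by auto
        then show ?case using elim by (simp add: pole)
      qed
    qed (simp add: B_def)
  qed measurable
  finally have "AE z in \<mu>. f (cosine e z) = 0"
    by (subst (asm) nn_integral_0_iff_AE) measurable
  moreover have "AE z in \<mu>. z \<noteq> 0" using \<mu> by (simp add: isotropic_def)
  ultimately show "AE z in \<mu>. snd z \<noteq> 0"
    by eventually_elim (auto simp: pole indicator_def split: if_splits)
qed

lemma isotropic_spherical_vector:
  fixes X :: "'a \<Rightarrow> real ^ 'n"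
  assumes "prob_space M" and X: "spherical_vector M X" and nz: "AE \<omega> in M. X \<omega> \<noteq> 0"
  shows "isotropic (distr M borel X)"
  unfolding isotropic_def
proof (intro conjI allI impI)
  have [measurable]: "X \<in> borel_measurable M" using X by (simp add: spherical_vector_def)
  interpret prob_space M by fact
  show "prob_space (distr M borel X)" by (rule prob_space_distr) measurable
  show "AE x in distr M borel X. x \<noteq> 0"
    using nz by (subst AE_distr_iff) measurable
  fix Q :: "real ^ 'n \<Rightarrow> real ^ 'n" assume Q: "orthogonal_transformation Q"
  have [measurable]: "Q \<in> borel_measurable borel"
    by (rule borel_measurable_orthogonal_transformation[OF Q])
  have "orthogonal_matrix (matrix Q)"
    using Q by (simp add: orthogonal_transformation_matrix)
  then have "distr M borel (\<lambda>\<omega>. matrix Q *v X \<omega>) = distr M borel X"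
    using X by (simp add: spherical_vector_def)
  moreover have "matrix Q *v x = Q x" for x
    using Q by (simp add: orthogonal_transformation_def matrix_works)
  ultimately have "distr M borel (\<lambda>\<omega>. Q (X \<omega>)) = distr M borel X"
    by (simp only:)
  then show "distr (distr M borel X) borel Q = distr M borel X"
    by (simp add: distr_distr o_def)
qed simp

section \<open>The correlation coefficient as a cosine\<close>

text \<open>An arbitrary isometry, followed by an orthogonal map that moves the image of the all-ones vector to the
  first axis. The right inverse \<open>K\<close> is what lifts rotations of the target to rotations of the source.\<close>

lemma isometry_splitting_off_mean:
  assumes dim: "CARD('n) = DIM('e) + 1"
  obtains L :: "real ^ 'n \<Rightarrow> real \<times> 'e::euclidean_space" and K
  where "orthogonal_transformation L" "orthogonal_transformation K" "\<And>y. L (K y) = y"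
    "L (\<chi> i. 1) = (sqrt (real CARD('n)), 0)"
proof -
  have "DIM(real ^ 'n) = DIM(real \<times> 'e)" using dim by simp
  then obtain f :: "real ^ 'n \<Rightarrow> real \<times> 'e" and g
    where fg: "linear f" "linear g" "\<And>x. norm (f x) = norm x" "\<And>y. norm (g y) = norm y"
      and inv: "\<And>y. f (g y) = y"
    by (rule isomorphisms_UNIV_UNIV) blast
  have ot: "orthogonal_transformation f" "orthogonal_transformation g"
    using fg by (simp_all add: orthogonal_transformation)
  have "norm (f (\<chi> i. 1)) = norm (sqrt (real CARD('n)), 0 :: 'e)"
    unfolding fg(3) by (simp add: norm_prod_def norm_vec_def L2_set_def)
  then obtain R :: "real \<times> 'e \<Rightarrow> real \<times> 'e"
    where R: "orthogonal_transformation R" "R (f (\<chi> i. 1)) = (sqrt (real CARD('n)), 0)"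
    by (rule orthogonal_transformation_exists_euclidean)
  show thesis
  proof
    show "orthogonal_transformation (R \<circ> f)"
      by (intro orthogonal_transformation_compose R(1) ot)
    show "orthogonal_transformation (g \<circ> inv R)"
      by (intro orthogonal_transformation_compose orthogonal_transformation_inv R(1) ot)
    show "(R \<circ> f) ((g \<circ> inv R) y) = y" for y
      using orthogonal_transformation_surj[OF R(1)] by (simp add: inv surj_f_inv_f)
    show "(R \<circ> f) (\<chi> i. 1) = (sqrt (real CARD('n)), 0)" using R(2) by simp
  qed
qed

text \<open>The first component of \<open>L x\<close> is \<open>sqrt n\<close> times the mean of \<open>x\<close>, so the second component carries
  exactly the centred vector: inner products of second components are sums of products of deviations.\<close>

lemma pearson_correlation_eq_cosine:
  fixes L :: "real ^ 'n \<Rightarrow> real \<times> 'e::euclidean_space"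
  assumes L: "orthogonal_transformation L"
    and one: "L (\<chi> i. 1) = (sqrt (real CARD('n)), 0)"
  shows "pearson_correlation x y = cosine (snd (L x)) (snd (L y))"
proof -
  have inn: "L x \<bullet> L y = x \<bullet> y" for x y
    using L by (simp add: orthogonal_transformation_def)
  have n: "sqrt (real CARD('n)) > 0" by simp
  have fst_L: "fst (L x) = sqrt (real CARD('n)) * vec_mean x" for x
  proof -
    have "sqrt (real CARD('n)) * fst (L x) = L (\<chi> i. 1) \<bullet> L x"
      by (simp add: one inner_prod_def)
    also have "\<dots> = real CARD('n) * vec_mean x"
      by (simp add: inn inner_vec_def vec_mean_def)
    also have "\<dots> = sqrt (real CARD('n)) * (sqrt (real CARD('n)) * vec_mean x)"
      by (simp flip: mult.assoc)
    finally show ?thesis using n by simp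
  qed
  have cov: "(\<Sum>i\<in>UNIV. (x $ i - vec_mean x) * (y $ i - vec_mean y)) = snd (L x) \<bullet> snd (L y)"
    for x y :: "real ^ 'n"
  proof -
    have sum: "(\<Sum>i\<in>UNIV. x $ i) = real CARD('n) * vec_mean x" for x :: "real ^ 'n"
      by (simp add: vec_mean_def)
    have "(\<Sum>i\<in>UNIV. (x $ i - vec_mean x) * (y $ i - vec_mean y))
        = (\<Sum>i\<in>UNIV. x $ i * y $ i) - vec_mean y * (\<Sum>i\<in>UNIV. x $ i)
          - vec_mean x * (\<Sum>i\<in>UNIV. y $ i) + real CARD('n) * (vec_mean x * vec_mean y)"
      by (simp add: algebra_simps sum.distrib sum_subtractf sum_distrib_left sum_distrib_right)
    also have "\<dots> = x \<bullet> y - real CARD('n) * (vec_mean x * vec_mean y)"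
      by (simp add: sum inner_vec_def algebra_simps)
    also have "real CARD('n) * (vec_mean x * vec_mean y)
        = (sqrt (real CARD('n)) * sqrt (real CARD('n))) * (vec_mean x * vec_mean y)"
      by simp
    also have "\<dots> = fst (L x) * fst (L y)"
      by (simp only: fst_L mult_ac)
    also have "x \<bullet> y - fst (L x) * fst (L y) = L x \<bullet> L y - fst (L x) * fst (L y)"
      by (simp only: inn)
    finally show ?thesis by (simp add: inner_prod_def)
  qed
  have var: "sqrt (\<Sum>i\<in>UNIV. (x $ i - vec_mean x)\<^sup>2) = norm (snd (L x))" for x
    using cov[of x x] by (simp add: power2_eq_square norm_eq_sqrt_inner)
  show ?thesis
    by (simp add: pearson_correlation_def cov cosine_def real_sqrt_mult var)
qed

lemma (in prob_space) indep_vars_imp_indep_var: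
  assumes X: "indep_vars N X I" and ij: "i \<in> I" "j \<in> I" "i \<noteq> j"
  shows "indep_var (N i) (X i) (N j) (X j)"
proof -
  have "indep_var (N i) ((\<lambda>f. f i) \<circ> (\<lambda>\<omega>. restrict (\<lambda>k. X k \<omega>) {i}))
                  (N j) ((\<lambda>f. f j) \<circ> (\<lambda>\<omega>. restrict (\<lambda>k. X k \<omega>) {j}))"
    by (rule indep_var_compose[OF indep_var_restrict[OF X]]) (use ij in auto)
  then show ?thesis by (simp add: o_def)
qed

text \<open>Independence makes the joint law of the centred vectors a product, so one of them may be replaced by
  the fixed vector \<open>e\<close> and the other by a uniform point of the ball.\<close>

theorem nn_integral_pearson_correlation:
  fixes M :: "'a measure" and X Y :: "'a \<Rightarrow> real ^ 'n" and e :: "'e::euclidean_space"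
  assumes "prob_space M" and indep: "prob_space.indep_var M borel X borel Y"
    and sph: "spherical_vector M X" "spherical_vector M Y"
    and nz: "AE \<omega> in M. X \<omega> \<noteq> 0" "AE \<omega> in M. Y \<omega> \<noteq> 0"
    and dim: "CARD('n) = DIM('e) + 1" and e: "e \<noteq> 0"
    and [measurable]: "f \<in> borel_measurable borel"
  shows "(\<integral>\<^sup>+\<omega>. f (pearson_correlation (X \<omega>) (Y \<omega>)) \<partial>M)
       = (\<integral>\<^sup>+z. f (cosine e z) \<partial>uniform_measure lborel (ball 0 1))"
proof -
  interpret prob_space M by fact
  obtain L :: "real ^ 'n \<Rightarrow> real \<times> 'e" and K
    where L: "orthogonal_transformation L" "orthogonal_transformation K" "\<And>y. L (K y) = y"
    and one: "L (\<chi> i. 1) = (sqrt (real CARD('n)), 0)"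
    using isometry_splitting_off_mean[OF dim] by blast
  define P where "P x = snd (L x)" for x
  have [measurable]: "L \<in> borel_measurable borel"
    by (rule borel_measurable_orthogonal_transformation[OF L(1)])
  have [measurable]: "snd \<in> borel_measurable (borel :: (real \<times> 'e) measure)"
    by (intro borel_measurable_continuous_onI continuous_intros)
  have [measurable]: "P \<in> borel_measurable borel" unfolding P_def by measurable
  have [measurable]: "X \<in> borel_measurable M" "Y \<in> borel_measurable M"
    using sph by (simp_all add: spherical_vector_def)
  have iso: "isotropic (distr M borel (\<lambda>\<omega>. P (Z \<omega>)))"
    if Z: "spherical_vector M Z" "AE \<omega> in M. Z \<omega> \<noteq> 0" for Z :: "'a \<Rightarrow> real ^ 'n"
  proof -
    have [measurable]: "Z \<in> borel_measurable M" using Z by (simp add: spherical_vector_def)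
    have "isotropic (distr (distr (distr M borel Z) borel L) borel snd)"
      by (intro isotropic_distr_snd isotropic_distr_isometry[OF _ L]
            isotropic_spherical_vector Z prob_space_axioms)
    then show ?thesis by (simp add: distr_distr o_def P_def)
  qed
  let ?\<mu> = "distr M borel (\<lambda>\<omega>. P (X \<omega>))" and ?\<nu> = "distr M borel (\<lambda>\<omega>. P (Y \<omega>))"
  have "indep_var borel (P \<circ> X) borel (P \<circ> Y)"
    by (rule indep_var_compose[OF indep]) measurable
  then have joint: "?\<mu> \<Otimes>\<^sub>M ?\<nu> = distr M (borel \<Otimes>\<^sub>M borel) (\<lambda>\<omega>. (P (X \<omega>), P (Y \<omega>)))"
    by (simp add: indep_var_distribution_eq o_def)
  interpret \<nu>: prob_space ?\<nu> by (rule prob_space_distr) measurable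
  have "(\<integral>\<^sup>+\<omega>. f (pearson_correlation (X \<omega>) (Y \<omega>)) \<partial>M) = (\<integral>\<^sup>+\<omega>. f (cosine (P (X \<omega>)) (P (Y \<omega>))) \<partial>M)"
    by (simp add: pearson_correlation_eq_cosine[OF L(1) one] P_def)
  also have "\<dots> = (\<integral>\<^sup>+z. f (cosine (fst z) (snd z)) \<partial>(?\<mu> \<Otimes>\<^sub>M ?\<nu>))"
    unfolding joint by (subst nn_integral_distr) simp_all
  also have "\<dots> = (\<integral>\<^sup>+x. \<integral>\<^sup>+y. f (cosine x y) \<partial>?\<nu> \<partial>?\<mu>)"
    by (subst \<nu>.nn_integral_fst[symmetric]) simp_all
  also have "\<dots> = (\<integral>\<^sup>+y. f (cosine e y) \<partial>?\<nu>)"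
    by (rule nn_integral_cosine_pair) (use iso sph nz e in auto)
  also have "\<dots> = (\<integral>\<^sup>+z. f (cosine e z) \<partial>uniform_measure lborel (ball 0 1))"
    by (rule nn_integral_cosine_universal[OF iso[OF sph(2) nz(2)] isotropic_uniform_ball _ e]) measurable
  finally show ?thesis .
qed

section \<open>The cosine of a uniform point of the ball\<close>

text \<open>The substitution \<open>t = s / sqrt (1 + s\<^sup>2)\<close>, which maps the line increasingly onto \<open>(-1, 1)\<close> with derivative
  \<open>(1 + s\<^sup>2) powr (-3 / 2)\<close>.\<close>

lemma nn_integral_slope_to_cosine:
  fixes g :: "real \<Rightarrow> ennreal"
  assumes [measurable]: "g \<in> borel_measurable borel"
  shows "(\<integral>\<^sup>+s. g (s / sqrt (1 + s\<^sup>2)) * ennreal (1 / sqrt (1 + s\<^sup>2) ^ 3) \<partial>lborel)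
       = (\<integral>\<^sup>+t. g t * indicator {-1<..<1} t \<partial>lborel)"
proof -
  define \<sigma> :: "real \<Rightarrow> real" where "\<sigma> s = s / sqrt (1 + s\<^sup>2)" for s
  define k :: "real \<Rightarrow> real" where "k s = 1 / sqrt (1 + s\<^sup>2) ^ 3" for s
  have [measurable]: "\<sigma> \<in> borel_measurable borel" "k \<in> borel_measurable borel"
    unfolding \<sigma>_def k_def by measurable
  have pos: "1 + s\<^sup>2 > 0" for s :: real
    by (simp add: add_pos_nonneg)
  have k_pos: "k s > 0" for s
    using pos[of s] by (simp add: k_def)
  have deriv: "DERIV \<sigma> s :> k s" for s
  proof -
    define q where "q = sqrt (1 + s\<^sup>2)"
    have q: "q > 0" "q\<^sup>2 = 1 + s\<^sup>2" using pos[of s] by (simp_all add: q_def)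
    have "DERIV \<sigma> s :> (q - s * (s / q)) / q\<^sup>2"
      unfolding \<sigma>_def[abs_def] q_def using pos[of s]
      by (auto intro!: derivative_eq_intros simp: power2_eq_square field_simps)
    also have "(q - s * (s / q)) / q\<^sup>2 = (q\<^sup>2 - s\<^sup>2) / q ^ 3"
      using q(1) by (simp add: field_simps power2_eq_square power3_eq_cube)
    also have "\<dots> = k s"
      using q(2) by (simp add: k_def q_def)
    finally show ?thesis .
  qed
  have mono: "\<sigma> a < \<sigma> b" if "a < b" for a b
    using that by (rule DERIV_pos_imp_increasing) (use deriv k_pos in blast)
  then have less_iff: "\<sigma> a < \<sigma> b \<longleftrightarrow> a < b" for a b
    by (metis linorder_less_linear order_less_asym)
  have bound: "\<bar>\<sigma> s\<bar> < 1" for s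
  proof -
    have "\<bar>s\<bar> < sqrt (1 + s\<^sup>2)" by (rule real_less_rsqrt) simp
    then show ?thesis using pos[of s] by (simp add: \<sigma>_def abs_divide)
  qed
  have lim: "(\<sigma> \<longlongrightarrow> 1) at_top"
  proof -
    have "((\<lambda>s::real. 1 / (1 + s\<^sup>2)) \<longlongrightarrow> 0) at_top"
      by (intro tendsto_divide_0[OF tendsto_const] filterlim_at_top_imp_at_infinity
            filterlim_tendsto_add_at_top[OF tendsto_const] filterlim_pow_at_top filterlim_ident) simp
    then have "((\<lambda>s::real. sqrt (1 - 1 / (1 + s\<^sup>2))) \<longlongrightarrow> sqrt (1 - 0)) at_top"
      by (intro tendsto_intros)
    moreover have "eventually (\<lambda>s. sqrt (1 - 1 / (1 + s\<^sup>2)) = \<sigma> s) at_top"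
      using eventually_ge_at_top[of 0]
    proof eventually_elim
      case (elim s)
      have "1 - 1 / (1 + s\<^sup>2) = s\<^sup>2 / (1 + s\<^sup>2)" using pos[of s] by (simp add: field_simps)
      then show ?case using elim by (simp add: \<sigma>_def real_sqrt_divide)
    qed
    ultimately show ?thesis by (auto intro: Lim_transform_eventually)
  qed
  \<comment> \<open>Both sides are integrals of \<open>g\<close> against a measure; the two measures are compared on upper rays.\<close>
  have tail: "(\<integral>\<^sup>+s. ennreal (k s) * indicator {y<..} s \<partial>lborel) = ennreal (1 - \<sigma> y)" for y
  proof -
    have "(\<integral>\<^sup>+s. ennreal (k s) * indicator {y<..} s \<partial>lborel)
        = (\<integral>\<^sup>+s. ennreal (k s) * indicator {y..} s \<partial>lborel)"
      using AE_lborel_singleton[of y]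
      by (intro nn_integral_cong_AE) (auto elim!: eventually_mono simp: indicator_def)
    also have "\<dots> = ennreal (1 - \<sigma> y)"
      using deriv k_pos lim by (intro nn_integral_FTC_atLeast) (auto simp: less_imp_le)
    finally show ?thesis .
  qed
  have total: "(\<integral>\<^sup>+s. ennreal (k s) \<partial>lborel) = 2"
  proof -
    have "(\<integral>\<^sup>+s. ennreal (k s) \<partial>lborel)
        = (\<integral>\<^sup>+s. ennreal (k s) * indicator {0<..} s + ennreal (k s) * indicator {..<0} s \<partial>lborel)"
      using AE_lborel_singleton[of 0]
      by (intro nn_integral_cong_AE) (auto elim!: eventually_mono simp: indicator_def)
    also have "\<dots> = (\<integral>\<^sup>+s. ennreal (k s) * indicator {0<..} s \<partial>lborel)
                 + (\<integral>\<^sup>+s. ennreal (k s) * indicator {..<0} s \<partial>lborel)"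
      by (rule nn_integral_add) measurable
    also have "(\<integral>\<^sup>+s. ennreal (k s) * indicator {..<0} s \<partial>lborel)
        = (\<integral>\<^sup>+s. ennreal (k s) * indicator {0<..} s \<partial>lborel)"
      by (subst nn_integral_real_affine[where c = "-1" and t = 0])
         (auto intro!: nn_integral_cong simp: k_def indicator_def)
    finally show ?thesis by (simp add: tail \<sigma>_def)
  qed
  let ?M = "distr (density lborel (\<lambda>s. ennreal (k s))) borel \<sigma>"
  let ?N = "density lborel (indicator {-1<..<1::real}) :: real measure"
  have M: "emeasure ?M {x<..} = (\<integral>\<^sup>+s. ennreal (k s) * indicator {x<..} (\<sigma> s) \<partial>lborel)" for x
    by (subst emeasure_distr)
       (auto simp: emeasure_density measurable_sets_borel[of \<sigma> borel] indicator_vimage)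
  have N: "emeasure ?N {x<..} = emeasure lborel {max x (-1)<..<1}" for x
  proof -
    have "{-1<..<1} \<inter> {x<..} = {max x (-1)<..<1}" by auto
    then show ?thesis
      by (simp add: emeasure_density indicator_inter_arith[symmetric])
  qed
  have eq: "emeasure ?M {x<..} = emeasure ?N {x<..}" for x
  proof -
    consider "x \<ge> 1" | "x \<le> -1" | "-1 < x" "x < 1" by linarith
    then show ?thesis
    proof cases
      case 1
      then have "\<not> x < \<sigma> s" for s using bound[of s] by linarith
      then show ?thesis using 1 unfolding M N by simp
    next
      case 2
      then have "x < \<sigma> s" for s using bound[of s] by linarith
      then show ?thesis using 2 unfolding M N by (simp add: total max_absorb2)
    next
      case 3
      define y where "y = x / sqrt (1 - x\<^sup>2)"
      have x2: "x\<^sup>2 < 1" using 3 by (simp add: abs_square_less_1 abs_less_iff)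
      then have "1 + y\<^sup>2 = 1 / (1 - x\<^sup>2)"
        by (simp add: y_def power_divide field_simps)
      then have "\<sigma> y = x"
        using x2 by (simp add: \<sigma>_def real_sqrt_divide) (simp add: y_def)
      then have "x < \<sigma> s \<longleftrightarrow> y < s" for s using less_iff[of y s] by simp
      then have "emeasure ?M {x<..} = (\<integral>\<^sup>+s. ennreal (k s) * indicator {y<..} s \<partial>lborel)"
        unfolding M by (simp add: indicator_def)
      then show ?thesis using 3 \<open>\<sigma> y = x\<close> unfolding N by (simp add: tail)
    qed
  qed
  have "?M = ?N"
  proof (rule measure_eqI_lessThan)
    show "emeasure ?M {x<..} < \<infinity>" for x
      unfolding eq N by (cases "x \<le> 1") (simp_all add: max_def)
  qed (auto simp: eq)
  then have "(\<integral>\<^sup>+t. g t \<partial>?M) = (\<integral>\<^sup>+t. g t \<partial>?N)" by simp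
  then show ?thesis
    by (simp add: nn_integral_distr nn_integral_density \<sigma>_def k_def mult.commute)
qed

lemma nn_integral_lborel_scaleR:
  fixes f :: "'v::euclidean_space \<Rightarrow> ennreal"
  assumes [measurable]: "f \<in> borel_measurable borel" and c: "c > 0"
  shows "(\<integral>\<^sup>+v. f (c *\<^sub>R v) \<partial>lborel) = ennreal (1 / c ^ DIM('v)) * (\<integral>\<^sup>+v. f v \<partial>lborel)"
proof -
  have "(\<integral>\<^sup>+v. f v \<partial>lborel)
      = (\<integral>\<^sup>+v. f v \<partial>density (distr lborel borel (\<lambda>x. 0 + c *\<^sub>R x)) (\<lambda>_. ennreal (\<bar>c\<bar> ^ DIM('v))))"
    using c by (subst lborel_affine[of c 0]) simp_all
  also have "\<dots> = ennreal (c ^ DIM('v)) * (\<integral>\<^sup>+v. f (c *\<^sub>R v) \<partial>lborel)"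
    using c by (simp add: nn_integral_density nn_integral_distr nn_integral_cmult)
  finally have "ennreal (1 / c ^ DIM('v)) * (\<integral>\<^sup>+v. f v \<partial>lborel)
      = (ennreal (1 / c ^ DIM('v)) * ennreal (c ^ DIM('v))) * (\<integral>\<^sup>+v. f (c *\<^sub>R v) \<partial>lborel)"
    by (simp add: mult.assoc)
  also have "ennreal (1 / c ^ DIM('v)) * ennreal (c ^ DIM('v)) = 1"
    using c by (simp flip: ennreal_mult)
  finally show ?thesis by simp
qed

text \<open>For \<open>v \<noteq> 0\<close> write \<open>a = norm v * s\<close>. The point \<open>(a, v)\<close> then has norm \<open>norm v * sqrt (1 + s\<^sup>2)\<close>, so its
  cosine depends on \<open>s\<close> alone, while rescaling \<open>v\<close> makes the ball condition independent of \<open>s\<close>. The two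
  variables separate, and what remains is a power of \<open>1 + s\<^sup>2\<close>.\<close>

lemma nn_integral_ball_cosine_pole:
  fixes h :: "real \<Rightarrow> ennreal"
  assumes [measurable]: "h \<in> borel_measurable borel"
  defines "e \<equiv> (1, 0) :: real \<times> 'v::euclidean_space"
  shows "(\<integral>\<^sup>+z. h (cosine e z) * indicator (ball 0 1) z \<partial>lborel)
       = (\<integral>\<^sup>+v. ennreal (norm v) * indicator (ball (0::'v) 1) v \<partial>lborel) *
         (\<integral>\<^sup>+t. h t * ennreal ((1 - t\<^sup>2) powr ((real DIM('v) - 2) / 2)) * indicator {-1<..<1} t \<partial>lborel)"
    (is "_ = ?C * _")
proof -
  define \<sigma> :: "real \<Rightarrow> real" where "\<sigma> s = s / sqrt (1 + s\<^sup>2)" for s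
  define q :: "real \<Rightarrow> real" where "q s = sqrt (1 + s\<^sup>2)" for s
  have [measurable]: "\<sigma> \<in> borel_measurable borel" "q \<in> borel_measurable borel"
    unfolding \<sigma>_def q_def by measurable
  have q: "q s > 0" "(q s)\<^sup>2 = 1 + s\<^sup>2" for s
    by (simp_all add: q_def add_pos_nonneg)
  define B where "B = ball (0::'v) 1"
  have [measurable]: "B \<in> sets borel" by (simp add: B_def)
  define F :: "real \<Rightarrow> 'v \<Rightarrow> ennreal"
    where "F a v = h (a / sqrt (a\<^sup>2 + (norm v)\<^sup>2)) * indicator {z. z < 1} (sqrt (a\<^sup>2 + (norm v)\<^sup>2))" for a v
  have [measurable]: "case_prod F \<in> borel_measurable (borel \<Otimes>\<^sub>M borel)"
    unfolding F_def by measurable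
  have line: "(\<integral>\<^sup>+a. F a v \<partial>lborel)
      = (\<integral>\<^sup>+s. h (\<sigma> s) * (ennreal (norm v) * indicator B (q s *\<^sub>R v)) \<partial>lborel)"
    if v: "v \<noteq> 0" for v
  proof -
    have r: "sqrt ((norm v * s)\<^sup>2 + (norm v)\<^sup>2) = norm v * q s" for s
    proof -
      have "(norm v * s)\<^sup>2 + (norm v)\<^sup>2 = (norm v)\<^sup>2 * (1 + s\<^sup>2)"
        by (simp add: power_mult_distrib algebra_simps)
      then show ?thesis by (simp add: q_def real_sqrt_mult)
    qed
    have "(\<integral>\<^sup>+a. F a v \<partial>lborel) = ennreal (norm v) * (\<integral>\<^sup>+s. F (norm v * s) v \<partial>lborel)"
      using v by (subst nn_integral_real_affine[where c = "norm v" and t = 0]) simp_all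
    also have "\<dots> = (\<integral>\<^sup>+s. ennreal (norm v) * F (norm v * s) v \<partial>lborel)"
      by (rule nn_integral_cmult[symmetric]) simp
    also have "\<dots> = (\<integral>\<^sup>+s. h (\<sigma> s) * (ennreal (norm v) * indicator B (q s *\<^sub>R v)) \<partial>lborel)"
    proof (rule nn_integral_cong)
      fix s
      have "indicator {z. z < 1} (norm v * q s) = (indicator B (q s *\<^sub>R v) :: ennreal)"
        using q(1)[of s] by (simp add: indicator_def B_def mult.commute)
      moreover have "F (norm v * s) v = h (\<sigma> s) * indicator {z. z < 1} (norm v * q s)"
        unfolding F_def r using v by (simp add: \<sigma>_def q_def)
      ultimately show "ennreal (norm v) * F (norm v * s) v
          = h (\<sigma> s) * (ennreal (norm v) * indicator B (q s *\<^sub>R v))"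
        by (simp only: mult.left_commute)
    qed
    finally show ?thesis .
  qed
  \<comment> \<open>Substitute \<open>w = q s *\<^sub>R v\<close>: one power of \<open>q s\<close> comes from \<open>norm v\<close>, the others from the volume.\<close>
  have slope: "(\<integral>\<^sup>+v. ennreal (norm v) * indicator B (q s *\<^sub>R v) \<partial>lborel)
      = ennreal (1 / q s ^ (DIM('v) + 1)) * ?C" for s
  proof -
    have meas: "(\<lambda>v. ennreal (norm v) * indicator B v) \<in> borel_measurable borel"
      by measurable
    have "1 / q s * (1 / q s ^ DIM('v)) = 1 / q s ^ (DIM('v) + 1)"
      by simp
    then have const: "ennreal (1 / q s) * ennreal (1 / q s ^ DIM('v)) = ennreal (1 / q s ^ (DIM('v) + 1))"
      using q(1)[of s] by (subst ennreal_mult[symmetric]) (simp_all only: zero_le_divide_1_iff less_imp_le zero_le_power)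
    have norm: "ennreal (norm v) = ennreal (1 / q s) * ennreal (norm (q s *\<^sub>R v))" for v :: 'v
      using q(1)[of s] by (subst ennreal_mult[symmetric]) simp_all
    have "(\<integral>\<^sup>+v. ennreal (norm v) * indicator B (q s *\<^sub>R v) \<partial>lborel)
        = (\<integral>\<^sup>+v. ennreal (1 / q s) * (ennreal (norm (q s *\<^sub>R v)) * indicator B (q s *\<^sub>R v)) \<partial>lborel)"
      by (rule nn_integral_cong) (subst norm, rule mult.assoc)
    also have "\<dots> = ennreal (1 / q s)
        * (\<integral>\<^sup>+v. ennreal (norm (q s *\<^sub>R v)) * indicator B (q s *\<^sub>R v) \<partial>lborel)"
      by (rule nn_integral_cmult) measurable
    also have "\<dots> = ennreal (1 / q s) * (ennreal (1 / q s ^ DIM('v)) * ?C)"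
      using nn_integral_lborel_scaleR[OF meas q(1)[of s]] by (simp only: B_def)
    also have "\<dots> = ennreal (1 / q s ^ (DIM('v) + 1)) * ?C"
      by (simp only: const mult.assoc[symmetric])
    finally show ?thesis .
  qed
  \<comment> \<open>Since \<open>1 - (\<sigma> s)\<^sup>2 = (q s) powr (-2)\<close>, splitting off the factor \<open>1 / q s ^ 3\<close>, which is the derivative of
    \<open>\<sigma>\<close>, leaves a function of \<open>\<sigma> s\<close> alone.\<close>
  have jac: "1 / q s ^ (DIM('v) + 1) = (1 - (\<sigma> s)\<^sup>2) powr ((real DIM('v) - 2) / 2) * (1 / q s ^ 3)" for s
  proof -
    have "\<sigma> s = s / q s" by (simp add: \<sigma>_def q_def)
    then have "1 - (\<sigma> s)\<^sup>2 = ((q s)\<^sup>2 - s\<^sup>2) / (q s)\<^sup>2"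
      using q(1)[of s] by (simp add: power_divide diff_divide_distrib)
    also have "(q s)\<^sup>2 - s\<^sup>2 = 1" by (simp add: q(2))
    also have "1 / (q s)\<^sup>2 = q s powr (-2)"
      using q(1)[of s] by (simp add: powr_minus_divide powr_numeral)
    finally have base: "1 - (\<sigma> s)\<^sup>2 = q s powr (-2)" .
    have "-2 * ((real DIM('v) - 2) / 2) = 2 - real DIM('v)" by simp
    then have "(1 - (\<sigma> s)\<^sup>2) powr ((real DIM('v) - 2) / 2) = q s powr (2 - real DIM('v))"
      by (simp only: base powr_powr)
    moreover have "1 / q s ^ n = q s powr (- real n)" for n
      using q(1)[of s] by (simp add: powr_minus_divide powr_realpow)
    ultimately show ?thesis
      by (simp only: powr_add[symmetric]) simp
  qed
  have jac': "ennreal (1 / q s ^ (DIM('v) + 1))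
      = ennreal ((1 - (\<sigma> s)\<^sup>2) powr ((real DIM('v) - 2) / 2)) * ennreal (1 / q s ^ 3)" for s
    unfolding jac using q(1)[of s] by (intro ennreal_mult) simp_all
  have "(\<integral>\<^sup>+z. h (cosine e z) * indicator (ball 0 1) z \<partial>lborel)
      = (\<integral>\<^sup>+z. case_prod F z \<partial>(lborel \<Otimes>\<^sub>M lborel))"
    unfolding lborel_prod
    by (intro nn_integral_cong)
       (auto simp: F_def e_def cosine_def norm_prod_def inner_prod_def indicator_def split: prod.splits)
  also have "\<dots> = (\<integral>\<^sup>+v. \<integral>\<^sup>+a. F a v \<partial>lborel \<partial>lborel)"
    by (subst lborel_pair.nn_integral_snd[symmetric]) simp_all
  also have "\<dots> = (\<integral>\<^sup>+v. \<integral>\<^sup>+s. h (\<sigma> s) * (ennreal (norm v) * indicator B (q s *\<^sub>R v)) \<partial>lborel \<partial>lborel)"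
    using AE_lborel_singleton[of "0::'v"]
    by (intro nn_integral_cong_AE) (auto elim!: eventually_mono simp: line)
  also have "\<dots> = (\<integral>\<^sup>+s. \<integral>\<^sup>+v. h (\<sigma> s) * (ennreal (norm v) * indicator B (q s *\<^sub>R v)) \<partial>lborel \<partial>lborel)"
    by (rule lborel_pair.Fubini') measurable
  also have "\<dots> = (\<integral>\<^sup>+s. h (\<sigma> s) * (ennreal (1 / q s ^ (DIM('v) + 1)) * ?C) \<partial>lborel)"
    by (simp add: nn_integral_cmult slope del: power_Suc)
  also have "\<dots> = (\<integral>\<^sup>+s. ?C * (h (\<sigma> s) * ennreal ((1 - (\<sigma> s)\<^sup>2) powr ((real DIM('v) - 2) / 2))
                         * ennreal (1 / q s ^ 3)) \<partial>lborel)"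
    by (simp only: jac' mult_ac)
  also have "\<dots> = ?C * (\<integral>\<^sup>+s. h (\<sigma> s) * ennreal ((1 - (\<sigma> s)\<^sup>2) powr ((real DIM('v) - 2) / 2))
                         * ennreal (1 / q s ^ 3) \<partial>lborel)"
    by (rule nn_integral_cmult) measurable
  also have "(\<integral>\<^sup>+s. h (\<sigma> s) * ennreal ((1 - (\<sigma> s)\<^sup>2) powr ((real DIM('v) - 2) / 2))
                         * ennreal (1 / q s ^ 3) \<partial>lborel)
      = (\<integral>\<^sup>+t. h t * ennreal ((1 - t\<^sup>2) powr ((real DIM('v) - 2) / 2)) * indicator {-1<..<1} t \<partial>lborel)"
    unfolding \<sigma>_def q_def by (rule nn_integral_slope_to_cosine) measurable
  finally show ?thesis .
qed

section \<open>The law of the correlation coefficient\<close>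

lemma borel_measurable_pearson_correlation:
  fixes X Y :: "'a \<Rightarrow> real ^ 'n"
  assumes [measurable]: "X \<in> borel_measurable M" "Y \<in> borel_measurable M"
  shows "(\<lambda>\<omega>. pearson_correlation (X \<omega>) (Y \<omega>)) \<in> borel_measurable M"
proof -
  have [measurable]: "(\<lambda>x :: real ^ 'n. x $ i) \<in> borel_measurable borel" for i
    by (intro borel_measurable_continuous_onI continuous_intros)
  show ?thesis unfolding pearson_correlation_def vec_mean_def by measurable
qed

text \<open>The type \<open>'v\<close> serves to provide a space of dimension \<open>n - 2\<close>: the second component of the isometry that splits
  off the mean is taken in \<open>\<real> \<times> 'v\<close>, whose first axis is the pole.\<close>

theorem distributed_pearson_correlation:
  fixes M :: "'a measure" and X Y :: "'a \<Rightarrow> real ^ 'n"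
  assumes "prob_space M" and indep: "prob_space.indep_var M borel X borel Y"
    and sph: "spherical_vector M X" "spherical_vector M Y"
    and nz: "AE \<omega> in M. X \<omega> \<noteq> 0" "AE \<omega> in M. Y \<omega> \<noteq> 0"
    and dim: "CARD('n) = DIM('v::euclidean_space) + 2"
    and I: "(\<integral>\<^sup>+t. ennreal ((1 - t\<^sup>2) powr ((real CARD('n) - 4) / 2)) * indicator {-1<..<1} t \<partial>lborel)
             = ennreal I" "I > 0"
  shows "distributed M lborel (\<lambda>\<omega>. pearson_correlation (X \<omega>) (Y \<omega>))
           (\<lambda>r. ennreal (indicator {-1<..<1} r * (1 - r\<^sup>2) powr ((real CARD('n) - 4) / 2) / I))"
proof -
  interpret prob_space M by fact
  have [measurable]: "X \<in> borel_measurable M" "Y \<in> borel_measurable M"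
    using sph by (simp_all add: spherical_vector_def)
  let ?\<rho> = "\<lambda>\<omega>. pearson_correlation (X \<omega>) (Y \<omega>)"
  let ?w = "\<lambda>t::real. (1 - t\<^sup>2) powr ((real CARD('n) - 4) / 2)"
  have \<rho> [measurable]: "?\<rho> \<in> borel_measurable M"
    by (rule borel_measurable_pearson_correlation) measurable
  define e :: "real \<times> 'v" where "e = (1, 0)"
  have e: "e \<noteq> 0" by (simp add: e_def zero_prod_def)
  define B where "B = ball (0 :: real \<times> 'v) 1"
  have [measurable]: "B \<in> sets borel" by (simp add: B_def)
  define K where "K = (\<integral>\<^sup>+v. ennreal (norm v) * indicator (ball (0::'v) 1) v \<partial>lborel) / emeasure lborel B"
  have exponent: "(real DIM('v) - 2) / 2 = (real CARD('n) - 4) / 2"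
    using dim by simp
  have law: "(\<integral>\<^sup>+\<omega>. h (?\<rho> \<omega>) \<partial>M) = K * (\<integral>\<^sup>+t. h t * ennreal (?w t) * indicator {-1<..<1} t \<partial>lborel)"
    if h [measurable]: "h \<in> borel_measurable borel" for h :: "real \<Rightarrow> ennreal"
  proof -
    have "(\<integral>\<^sup>+\<omega>. h (?\<rho> \<omega>) \<partial>M) = (\<integral>\<^sup>+z. h (cosine e z) \<partial>uniform_measure lborel B)"
      unfolding B_def using dim
      by (intro nn_integral_pearson_correlation assms(1) indep sph nz e h) simp
    also have "\<dots> = (\<integral>\<^sup>+z. h (cosine e z) * indicator B z \<partial>lborel) / emeasure lborel B"
      by (rule nn_integral_uniform_measure) measurable
    also have "\<dots> = K * (\<integral>\<^sup>+t. h t * ennreal (?w t) * indicator {-1<..<1} t \<partial>lborel)"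
      unfolding B_def e_def nn_integral_ball_cosine_pole[OF h] exponent
      by (simp add: K_def B_def divide_ennreal_def mult_ac)
    finally show ?thesis .
  qed
  \<comment> \<open>The constant \<open>K\<close> is found from the total mass, not from volumes of balls.\<close>
  have "1 = K * ennreal I"
    using law[of "\<lambda>_. 1"] I(1) by (simp add: emeasure_space_1)
  then have K: "K = ennreal (1 / I)"
  proof -
    have "K = K * (ennreal I * ennreal (1 / I))"
      using I(2) by (simp flip: ennreal_mult)
    then show ?thesis using \<open>1 = K * ennreal I\<close> by (simp flip: mult.assoc)
  qed
  let ?d = "\<lambda>r. ennreal (indicator {-1<..<1} r * ?w r / I)"
  have "distr M lborel ?\<rho> = density lborel ?d"
  proof (rule measure_eqI)
    fix A assume "A \<in> sets (distr M lborel ?\<rho>)"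
    then have [measurable]: "A \<in> sets borel" by simp
    have "emeasure (distr M lborel ?\<rho>) A = (\<integral>\<^sup>+x. indicator A x \<partial>distr M lborel ?\<rho>)"
      by simp
    also have "\<dots> = (\<integral>\<^sup>+\<omega>. indicator A (?\<rho> \<omega>) \<partial>M)"
      by (rule nn_integral_distr) measurable
    also have "\<dots> = ennreal (1 / I) * (\<integral>\<^sup>+t. indicator A t * ennreal (?w t) * indicator {-1<..<1} t \<partial>lborel)"
      unfolding K[symmetric] by (rule law) measurable
    also have "\<dots> = (\<integral>\<^sup>+t. ennreal (1 / I) * (indicator A t * ennreal (?w t) * indicator {-1<..<1} t) \<partial>lborel)"
      by (rule nn_integral_cmult[symmetric]) measurable
    also have "\<dots> = (\<integral>\<^sup>+t. ?d t * indicator A t \<partial>lborel)"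
      using I(2) by (intro nn_integral_cong) (auto simp: indicator_def simp flip: ennreal_mult)
    also have "\<dots> = emeasure (density lborel ?d) A"
      by (rule emeasure_density[symmetric]) measurable
    finally show "emeasure (distr M lborel ?\<rho>) A = emeasure (density lborel ?d) A" .
  qed simp
  then show ?thesis by (simp add: distributed_def)
qed

text \<open>A version in which the weight may be given in closed form \<open>w\<close> and the density \<open>g\<close> may take any
  values at \<open>1\<close> and \<open>-1\<close>.\<close>

corollary distributed_pearson_correlation_cong:
  fixes M :: "'a measure" and X Y :: "'a \<Rightarrow> real ^ 'n" and g :: "real \<Rightarrow> ennreal"
  assumes "prob_space M" and indep: "prob_space.indep_var M borel X borel Y"
    and sph: "spherical_vector M X" "spherical_vector M Y"
    and nz: "AE \<omega> in M. X \<omega> \<noteq> 0" "AE \<omega> in M. Y \<omega> \<noteq> 0"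
    and dim: "CARD('n) = DIM('v::euclidean_space) + 2"
    and w: "\<And>r. -1 < r \<Longrightarrow> r < 1 \<Longrightarrow> (1 - r\<^sup>2) powr ((real CARD('n) - 4) / 2) = w r"
    and I: "(\<integral>\<^sup>+t. ennreal (w t) * indicator {-1<..<1} t \<partial>lborel) = ennreal I" "I > 0"
    and g: "g \<in> borel_measurable borel" "\<And>r. -1 < r \<Longrightarrow> r < 1 \<Longrightarrow> g r = ennreal (w r / I)"
      "\<And>r. 1 < \<bar>r\<bar> \<Longrightarrow> g r = 0"
  shows "distributed M lborel (\<lambda>\<omega>. pearson_correlation (X \<omega>) (Y \<omega>)) g"
proof -
  let ?w = "\<lambda>r::real. (1 - r\<^sup>2) powr ((real CARD('n) - 4) / 2)"
  have "(\<integral>\<^sup>+t. ennreal (?w t) * indicator {-1<..<1} t \<partial>lborel)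
      = (\<integral>\<^sup>+t. ennreal (w t) * indicator {-1<..<1} t \<partial>lborel)"
    by (intro nn_integral_cong) (auto simp: indicator_def w)
  then have "distributed M lborel (\<lambda>\<omega>. pearson_correlation (X \<omega>) (Y \<omega>))
      (\<lambda>r. ennreal (indicator {-1<..<1} r * ?w r / I))"
    using I by (intro distributed_pearson_correlation[OF assms(1) indep sph nz dim]) simp_all
  moreover have "AE r in lborel. ennreal (indicator {-1<..<1} r * ?w r / I) = g r"
    using AE_lborel_singleton[of "1::real"] AE_lborel_singleton[of "-1::real"]
  proof eventually_elim
    case (elim r)
    then consider "-1 < r" "r < 1" | "1 < \<bar>r\<bar>" by linarith
    then show ?case by cases (auto simp: g w indicator_def)
  qed
  ultimately show ?thesis
    using g(1) by (subst (asm) distributed_cong_density) simp_all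
qed

text \<open>Here the hyperplane is a line, and the cosine of \<open>1\<close> with \<open>z\<close> is the sign of \<open>z\<close>, which takes either value
  on one half of the interval \<open>(-1, 1)\<close>.\<close>

lemma pearson_correlation_dim2:
  fixes M :: "'a measure" and X Y :: "'a \<Rightarrow> real ^ 'n"
  assumes "prob_space M" and indep: "prob_space.indep_var M borel X borel Y"
    and sph: "spherical_vector M X" "spherical_vector M Y"
    and nz: "AE \<omega> in M. X \<omega> \<noteq> 0" "AE \<omega> in M. Y \<omega> \<noteq> 0"
    and dim: "CARD('n) = 2" and s: "s \<in> {-1, 1}"
  shows "measure M {\<omega> \<in> space M. pearson_correlation (X \<omega>) (Y \<omega>) = s} = 1 / 2"
proof -
  interpret prob_space M by fact
  have [measurable]: "X \<in> borel_measurable M" "Y \<in> borel_measurable M"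
    using sph by (simp_all add: spherical_vector_def)
  let ?\<rho> = "\<lambda>\<omega>. pearson_correlation (X \<omega>) (Y \<omega>)"
  have \<rho> [measurable]: "?\<rho> \<in> borel_measurable M"
    by (rule borel_measurable_pearson_correlation) measurable
  define H where "H = (if s = 1 then {0<..<1::real} else {-1<..<0})"
  have H: "(indicator {s} (cosine 1 z) :: ennreal) * indicator (ball 0 1) z = indicator H z" for z :: real
  proof -
    have "cosine 1 z = sgn z" by (simp add: cosine_def real_sgn_eq)
    then show ?thesis
      using s by (cases "0::real" z rule: linorder_cases) (auto simp: H_def indicator_def)
  qed
  have "(\<lambda>z. cosine (1::real) z) \<in> borel_measurable borel"
    by (rule borel_measurable_cosine[OF borel_measurable_const measurable_ident_sets[OF refl]])
  then have ind: "(\<lambda>z. indicator {s} (cosine (1::real) z) :: ennreal) \<in> borel_measurable borel"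
    by (rule measurable_compose) simp
  have "emeasure M {\<omega> \<in> space M. ?\<rho> \<omega> = s}
      = (\<integral>\<^sup>+\<omega>. indicator {\<omega> \<in> space M. ?\<rho> \<omega> = s} \<omega> \<partial>M)"
    by (rule nn_integral_indicator[symmetric]) measurable
  also have "\<dots> = (\<integral>\<^sup>+\<omega>. indicator {s} (?\<rho> \<omega>) \<partial>M)"
    by (intro nn_integral_cong) (simp add: indicator_def)
  also have "\<dots> = (\<integral>\<^sup>+z. indicator {s} (cosine (1::real) z) \<partial>uniform_measure lborel (ball 0 1))"
    by (intro nn_integral_pearson_correlation assms(1) indep sph nz) (simp_all add: dim)
  also have "\<dots> = (\<integral>\<^sup>+z. indicator {s} (cosine (1::real) z) * indicator (ball 0 1) z \<partial>lborel)
                / emeasure lborel (ball (0::real) 1)"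
    by (rule nn_integral_uniform_measure) (simp_all add: ind)
  also have "\<dots> = emeasure lborel H / emeasure lborel (ball (0::real) 1)"
    unfolding H by (subst nn_integral_indicator) (simp_all add: H_def)
  also have "\<dots> = ennreal (1 / 2)"
    by (simp add: H_def ball_eq_greaterThanLessThan divide_ennreal flip: ennreal_1 ennreal_numeral)
  finally show ?thesis by (rule measure_eq_emeasure_eq_ennreal[rotated]) simp
qed

section \<open>Arcsine, semicircle and the square of an arcsine variable\<close>

text \<open>The integrand may be unbounded at the ends of the interval, as \<open>1 / sqrt (1 - t\<^sup>2)\<close> is; continuity of the
  antiderivative up to the ends suffices.\<close>

lemma nn_integral_FTC_open:
  fixes F f :: "real \<Rightarrow> real"
  assumes ab: "a \<le> b" and [measurable]: "f \<in> borel_measurable borel"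
    and cont: "continuous_on {a..b} F"
    and deriv: "\<And>x. a < x \<Longrightarrow> x < b \<Longrightarrow> DERIV F x :> f x"
    and nonneg: "\<And>x. a < x \<Longrightarrow> x < b \<Longrightarrow> 0 \<le> f x"
  shows "(\<integral>\<^sup>+x. ennreal (f x) * indicator {a<..<b} x \<partial>lborel) = ennreal (F b - F a)"
proof -
  have "(f has_integral (F b - F a)) {a..b}"
    using ab cont deriv
    by (intro fundamental_theorem_of_calculus_interior)
       (auto simp: has_real_derivative_iff_has_vector_derivative)
  then have "(f has_integral (F b - F a)) {a<..<b}"
    by (simp add: has_integral_Icc_iff_Ioo)
  then have "((\<lambda>x. f x * indicator {a<..<b} x) has_integral (F b - F a)) UNIV"
    by (subst (asm) has_integral_restrict_UNIV[symmetric])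
       (simp only: indicator_times_eq_if mult.commute[of "f _"])
  then have "(\<integral>\<^sup>+x. ennreal (f x * indicator {a<..<b} x) \<partial>lborel) = ennreal (F b - F a)"
    by (intro nn_integral_has_integral_lborel) (auto simp: indicator_def nonneg)
  then show ?thesis
    by (simp add: ennreal_mult'' ennreal_indicator)
qed

lemma nn_integral_inverse_sqrt_circle:
  assumes c: "0 \<le> c" "c \<le> 1"
  shows "(\<integral>\<^sup>+t. ennreal (1 / sqrt (1 - t\<^sup>2)) * indicator {-c<..<c} t \<partial>lborel) = ennreal (2 * arcsin c)"
proof -
  have "t\<^sup>2 < 1" if "- c < t" "t < c" for t
    using that c by (simp add: abs_square_less_1 abs_less_iff)
  then have "(\<integral>\<^sup>+t. ennreal (1 / sqrt (1 - t\<^sup>2)) * indicator {-c<..<c} t \<partial>lborel)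
      = ennreal (arcsin c - arcsin (- c))"
    using c by (intro nn_integral_FTC_open)
      (auto intro!: continuous_on_arcsin' derivative_eq_intros continuous_intros simp: divide_simps)
  then show ?thesis using c by (simp add: arcsin_minus)
qed

lemma nn_integral_sqrt_circle:
  "(\<integral>\<^sup>+t. ennreal (sqrt (1 - t\<^sup>2)) * indicator {-1<..<1} t \<partial>lborel) = ennreal (pi / 2)"
proof -
  define F where "F t = (t * sqrt (1 - t\<^sup>2) + arcsin t) / 2" for t
  have "(\<integral>\<^sup>+t. ennreal (sqrt (1 - t\<^sup>2)) * indicator {-1<..<1} t \<partial>lborel) = ennreal (F 1 - F (- 1))"
  proof (rule nn_integral_FTC_open)
    show "continuous_on {-1..1} F" unfolding F_def
      by (intro continuous_intros) auto
    fix t :: real assume t: "-1 < t" "t < 1"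
    then have t2: "t\<^sup>2 < 1" by (simp add: abs_square_less_1 abs_less_iff)
    define w where "w = sqrt (1 - t\<^sup>2)"
    have w: "w > 0" "w\<^sup>2 = 1 - t\<^sup>2" using t2 by (simp_all add: w_def)
    have "DERIV F t :> (w + t * (- t / w) + 1 / w) / 2"
      unfolding F_def[abs_def] w_def using t t2
      by (auto intro!: derivative_eq_intros simp: field_simps)
    also have "(w + t * (- t / w) + 1 / w) / 2 = (w\<^sup>2 + (1 - t\<^sup>2)) / (2 * w)"
      using w(1) by (simp add: field_simps power2_eq_square)
    also have "\<dots> = (w\<^sup>2 + w\<^sup>2) / (2 * w)"
      by (simp only: w(2))
    also have "\<dots> = w"
      using w(1) by (simp add: power2_eq_square)
    finally show "DERIV F t :> sqrt (1 - t\<^sup>2)" by (simp add: w_def)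
    show "0 \<le> sqrt (1 - t\<^sup>2)" using t2 by simp
  qed auto
  then show ?thesis by (simp add: F_def)
qed

lemma nn_integral_arcsine_density:
  assumes b: "0 \<le> b" "b \<le> 1"
  shows "(\<integral>\<^sup>+x. ennreal (arcsine_density x) * indicator {0<..<b} x \<partial>lborel) = ennreal (2 / pi * arcsin (sqrt b))"
proof -
  define F where "F x = 2 / pi * arcsin (sqrt x)" for x
  have "(\<integral>\<^sup>+x. ennreal (arcsine_density x) * indicator {0<..<b} x \<partial>lborel) = ennreal (F b - F 0)"
  proof (rule nn_integral_FTC_open)
    show "arcsine_density \<in> borel_measurable borel"
      unfolding arcsine_density_def[abs_def] by measurable
    show "continuous_on {0..b} F" unfolding F_def using b
      by (intro continuous_intros) (auto intro: order_trans[OF _ real_sqrt_ge_zero])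
    fix x :: real assume x: "0 < x" "x < b"
    then have x1: "x < 1" using b by simp
    have "-1 < sqrt x" using less_trans[of "-1" 0 "sqrt x"] x by simp
    have "DERIV F x :> 2 / pi * (1 / sqrt (1 - (sqrt x)\<^sup>2) * (1 / sqrt x / 2))"
      unfolding F_def[abs_def] using x x1 \<open>-1 < sqrt x\<close>
      by (auto intro!: derivative_eq_intros simp: field_simps)
    also have "2 / pi * (1 / sqrt (1 - (sqrt x)\<^sup>2) * (1 / sqrt x / 2)) = arcsine_density x"
      using x x1 by (simp add: arcsine_density_def real_sqrt_mult mult_ac)
    finally show "DERIV F x :> arcsine_density x" .
    show "0 \<le> arcsine_density x" using x x1 by (simp add: arcsine_density_def)
  qed (use b in auto)
  then show ?thesis by (simp add: F_def)
qed

text \<open>The distribution functions agree: for \<open>0 \<le> a \<le> 1\<close> and \<open>c = sqrt a\<close>, the event \<open>R\<^sup>2 \<le> a\<close> is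
  \<open>\<bar>R\<bar> \<le> c\<close>, of probability \<open>2 / pi * arcsin c\<close>, and as a function of \<open>a\<close> this is an antiderivative
  of the arcsine density.\<close>

lemma distributed_square_arcsine:
  assumes "prob_space M" and R: "distributed M lborel R
      (\<lambda>r. ennreal (if -1 < r \<and> r < 1 then 1 / pi * (1 / sqrt (1 - r\<^sup>2)) else 0))"
  shows "distributed M lborel (\<lambda>\<omega>. (R \<omega>)\<^sup>2) (\<lambda>x. ennreal (arcsine_density x))"
proof -
  interpret prob_space M by fact
  have [measurable]: "R \<in> borel_measurable M" using R by (simp add: distributed_def)
  \<comment> \<open>Clamping \<open>a\<close> to the unit interval treats all cases of the distribution function at once.\<close>
  define b where "b a = min 1 (max 0 a)" for a :: real
  have b: "0 \<le> b a" "b a \<le> 1" for a by (auto simp: b_def)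
  show ?thesis
  proof (rule distributedI_borel_atMost)
    show "arcsine_density \<in> borel_measurable borel"
      unfolding arcsine_density_def[abs_def] by measurable
    show "AE x in lborel. 0 \<le> arcsine_density x"
      by (auto simp: arcsine_density_def)
    show "(\<integral>\<^sup>+x. ennreal (arcsine_density x * indicator {..a} x) \<partial>lborel)
        = ennreal (2 / pi * arcsin (sqrt (b a)))" for a
    proof -
      have "(\<integral>\<^sup>+x. ennreal (arcsine_density x * indicator {..a} x) \<partial>lborel)
          = (\<integral>\<^sup>+x. ennreal (arcsine_density x) * indicator {0<..<b a} x \<partial>lborel)"
        using AE_lborel_singleton[of a]
        by (intro nn_integral_cong_AE) (auto elim!: eventually_mono simp: indicator_def arcsine_density_def b_def)
      then show ?thesis by (simp only: nn_integral_arcsine_density[OF b])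
    qed
    show "emeasure M {\<omega> \<in> space M. (R \<omega>)\<^sup>2 \<le> a} = ennreal (2 / pi * arcsin (sqrt (b a)))" for a
    proof -
      define c where "c = sqrt (b a)"
      have c: "0 \<le> c" "c \<le> 1" using b[of a] by (simp_all add: c_def)
      have range: "t\<^sup>2 \<le> a \<and> -1 < t \<and> t < 1 \<longleftrightarrow> -c < t \<and> t < c" if "t \<noteq> c" "t \<noteq> -c" for t
      proof -
        have c2: "c\<^sup>2 = b a" using b[of a] by (simp add: c_def)
        have "t\<^sup>2 \<noteq> c\<^sup>2"
          using that by (simp add: power2_eq_iff)
        moreover have "-1 < t \<and> t < 1 \<longleftrightarrow> t\<^sup>2 < 1"
          by (auto simp: abs_square_less_1 abs_less_iff)
        moreover have "-c < t \<and> t < c \<longleftrightarrow> t\<^sup>2 < c\<^sup>2"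
        proof -
          have "t\<^sup>2 < c\<^sup>2 \<longleftrightarrow> sqrt (t\<^sup>2) < sqrt (c\<^sup>2)"
            by (simp only: real_sqrt_less_iff)
          also have "\<dots> \<longleftrightarrow> \<bar>t\<bar> < c" using c by simp
          also have "\<dots> \<longleftrightarrow> -c < t \<and> t < c" by auto
          finally show ?thesis by blast
        qed
        moreover have "u \<le> a \<and> u < 1 \<longleftrightarrow> u < b a" if "u \<noteq> b a" "0 \<le> u" for u
          using that by (auto simp: b_def min_def max_def split: if_splits)
        ultimately show ?thesis
          unfolding c2 using zero_le_power2[of t] by metis
      qed
      have "emeasure M {\<omega> \<in> space M. (R \<omega>)\<^sup>2 \<le> a} = emeasure M (R -` {t. t\<^sup>2 \<le> a} \<inter> space M)"
        by (intro arg_cong[where f = "emeasure M"]) auto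
      also have "\<dots> = (\<integral>\<^sup>+t. ennreal (if -1 < t \<and> t < 1 then 1 / pi * (1 / sqrt (1 - t\<^sup>2)) else 0)
                         * indicator {t. t\<^sup>2 \<le> a} t \<partial>lborel)"
        by (rule distributed_emeasure[OF R]) measurable
      also have "\<dots> = (\<integral>\<^sup>+t. ennreal (1 / pi) * (ennreal (1 / sqrt (1 - t\<^sup>2)) * indicator {-c<..<c} t) \<partial>lborel)"
        using AE_lborel_singleton[of c] AE_lborel_singleton[of "-c"]
      proof (intro nn_integral_cong_AE, eventually_elim)
        case (elim t)
        have "ennreal (1 / pi * (1 / sqrt (1 - t\<^sup>2))) = ennreal (1 / pi) * ennreal (1 / sqrt (1 - t\<^sup>2))"
          by (rule ennreal_mult') simp
        then show ?case using range[of t] elim by (auto simp: indicator_def)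
      qed
      also have "\<dots> = ennreal (1 / pi) * ennreal (2 * arcsin c)"
        by (subst nn_integral_cmult) (simp_all add: nn_integral_inverse_sqrt_circle[OF c])
      also have "\<dots> = ennreal (2 / pi * arcsin c)"
        by (simp flip: ennreal_mult')
      finally show ?thesis by (simp add: c_def)
    qed
  qed measurable
qed

section \<open>Dimensions two to five\<close>

theorem corollary4p1:
  fixes M :: "'a measure" and p :: nat and X :: "nat \<Rightarrow> 'a \<Rightarrow> real ^ 'n"
  assumes "prob_space M"
    and indep: "prob_space.indep_vars M (\<lambda>_. borel) X {1..p}"
    and common: "\<forall>k\<in>{1..p}. distr M borel (X k) = distr M borel (X 1)"
    and spherical: "\<forall>k\<in>{1..p}. spherical_vector M (X k)"
    and nonzero: "measure M {\<omega> \<in> space M. X 1 \<omega> = 0} = 0"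
  defines "\<rho> \<equiv> \<lambda>i j \<omega>. pearson_correlation (X i \<omega>) (X j \<omega>)"
  shows "\<forall>i j. 1 \<le> i \<and> i < j \<and> j \<le> p \<longrightarrow>
     (CARD('n) = 2 \<longrightarrow>
        measure M {\<omega> \<in> space M. \<rho> i j \<omega> = 1} = 1 / 2 \<and>
        measure M {\<omega> \<in> space M. \<rho> i j \<omega> = -1} = 1 / 2) \<and>
     (CARD('n) = 3 \<longrightarrow>
        distributed M lborel (\<rho> i j)
          (\<lambda>r. ennreal (if -1 < r \<and> r < 1 then 1 / pi * (1 / sqrt (1 - r\<^sup>2)) else 0)) \<and>
        distributed M lborel (\<lambda>\<omega>. (\<rho> i j \<omega>)\<^sup>2) (\<lambda>x. ennreal (arcsine_density x))) \<and>
     (CARD('n) = 4 \<longrightarrow>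
        distributed M lborel (\<rho> i j)
          (\<lambda>r. ennreal (indicator {-1..1} r / measure lborel {-1..1::real}))) \<and>
     (CARD('n) = 5 \<longrightarrow>
        distributed M lborel (\<rho> i j)
          (\<lambda>r. ennreal (if \<bar>r\<bar> \<le> 1 then 2 / pi * sqrt (1 - r\<^sup>2) else 0)) \<and>
        distributed M lborel (\<rho> i j) (\<lambda>r. ennreal (semicircle_density 1 r)))"
proof (intro allI impI, elim conjE)
  fix i j :: nat assume ij: "1 \<le> i" "i < j" "j \<le> p"
  interpret prob_space M by fact
  have mem: "i \<in> {1..p}" "j \<in> {1..p}" "1 \<in> {1..p}" using ij by auto
  have meas [measurable]: "X k \<in> borel_measurable M" if "k \<in> {1..p}" for k
    using spherical that by (simp add: spherical_vector_def)
  have sph: "spherical_vector M (X i)" "spherical_vector M (X j)"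
    using spherical mem by auto
  have ind: "indep_var borel (X i) borel (X j)"
    using indep_vars_imp_indep_var[OF indep mem(1,2)] ij by simp
  have nz: "AE \<omega> in M. X k \<omega> \<noteq> 0" if k: "k \<in> {1..p}" for k
  proof -
    note [measurable] = meas[OF k] meas[OF mem(3)]
    have "{\<omega> \<in> space M. X 1 \<omega> = 0} \<in> sets M" by measurable
    then have "AE \<omega> in M. X 1 \<omega> \<noteq> 0"
      using nonzero by (subst AE_iff_measurable) (simp_all add: emeasure_eq_measure)
    then have "AE x in distr M borel (X 1). x \<noteq> 0"
      by (subst AE_distr_iff) measurable
    moreover have "distr M borel (X k) = distr M borel (X 1)"
      using common k by blast
    ultimately have "AE x in distr M borel (X k). x \<noteq> 0"
      by (simp only:)
    then show ?thesis by (subst (asm) AE_distr_iff) measurable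
  qed
  note nzij = nz[OF mem(1)] nz[OF mem(2)]
  have circle: "0 < 1 - r\<^sup>2" if "-1 < r" "r < 1" for r :: real
    using that by (simp add: abs_square_less_1 abs_less_iff)
  note law = distributed_pearson_correlation_cong[OF assms(1) ind sph nzij]
  show "(CARD('n) = 2 \<longrightarrow>
        measure M {\<omega> \<in> space M. \<rho> i j \<omega> = 1} = 1 / 2 \<and>
        measure M {\<omega> \<in> space M. \<rho> i j \<omega> = -1} = 1 / 2) \<and>
     (CARD('n) = 3 \<longrightarrow>
        distributed M lborel (\<rho> i j)
          (\<lambda>r. ennreal (if -1 < r \<and> r < 1 then 1 / pi * (1 / sqrt (1 - r\<^sup>2)) else 0)) \<and>
        distributed M lborel (\<lambda>\<omega>. (\<rho> i j \<omega>)\<^sup>2) (\<lambda>x. ennreal (arcsine_density x))) \<and>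
     (CARD('n) = 4 \<longrightarrow>
        distributed M lborel (\<rho> i j)
          (\<lambda>r. ennreal (indicator {-1..1} r / measure lborel {-1..1::real}))) \<and>
     (CARD('n) = 5 \<longrightarrow>
        distributed M lborel (\<rho> i j)
          (\<lambda>r. ennreal (if \<bar>r\<bar> \<le> 1 then 2 / pi * sqrt (1 - r\<^sup>2) else 0)) \<and>
        distributed M lborel (\<rho> i j) (\<lambda>r. ennreal (semicircle_density 1 r)))"
  proof (intro conjI impI)
    assume n: "CARD('n) = 2"
    show "measure M {\<omega> \<in> space M. \<rho> i j \<omega> = 1} = 1 / 2"
         "measure M {\<omega> \<in> space M. \<rho> i j \<omega> = -1} = 1 / 2"
      unfolding \<rho>_def by (rule pearson_correlation_dim2[OF assms(1) ind sph nzij n]; simp)+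
  next
    assume n: "CARD('n) = 3"
    have w: "(1 - r\<^sup>2) powr ((real CARD('n) - 4) / 2) = 1 / sqrt (1 - r\<^sup>2)"
      if "-1 < r" "r < 1" for r :: real
      using circle[OF that] by (simp add: n powr_minus_divide powr_half_sqrt)
    have I: "(\<integral>\<^sup>+t. ennreal (1 / sqrt (1 - t\<^sup>2)) * indicator {-1<..<1} t \<partial>lborel) = ennreal pi"
      using nn_integral_inverse_sqrt_circle[of 1] by simp
    show dens: "distributed M lborel (\<rho> i j)
        (\<lambda>r. ennreal (if -1 < r \<and> r < 1 then 1 / pi * (1 / sqrt (1 - r\<^sup>2)) else 0))"
      unfolding \<rho>_def by (rule law[where 'v = real, OF _ w I]) (auto simp: n mult.commute)
    show "distributed M lborel (\<lambda>\<omega>. (\<rho> i j \<omega>)\<^sup>2) (\<lambda>x. ennreal (arcsine_density x))"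
      by (rule distributed_square_arcsine[OF assms(1) dens])
  next
    assume n: "CARD('n) = 4"
    have w: "(1 - r\<^sup>2) powr ((real CARD('n) - 4) / 2) = 1" if "-1 < r" "r < 1" for r :: real
      using circle[OF that] by (simp add: n)
    have I: "(\<integral>\<^sup>+t. ennreal 1 * indicator {-1<..<1::real} t \<partial>lborel) = ennreal 2"
      by simp
    show "distributed M lborel (\<rho> i j)
        (\<lambda>r. ennreal (indicator {-1..1} r / measure lborel {-1..1::real}))"
      unfolding \<rho>_def
      by (rule law[where 'v = "real \<times> real", OF _ w I]) (auto simp: n indicator_def)
  next
    assume n: "CARD('n) = 5"
    have w: "(1 - r\<^sup>2) powr ((real CARD('n) - 4) / 2) = sqrt (1 - r\<^sup>2)"
      if "-1 < r" "r < 1" for r :: real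
      using circle[OF that] by (simp add: n powr_half_sqrt)
    show dens: "distributed M lborel (\<rho> i j)
        (\<lambda>r. ennreal (if \<bar>r\<bar> \<le> 1 then 2 / pi * sqrt (1 - r\<^sup>2) else 0))"
      unfolding \<rho>_def
      by (rule law[where 'v = "real \<times> real \<times> real", OF _ w nn_integral_sqrt_circle])
         (auto simp: n mult.commute)
    then show "distributed M lborel (\<rho> i j) (\<lambda>r. ennreal (semicircle_density 1 r))"
      by (simp only: semicircle_density_def[abs_def] power_one mult_1_right)
  qed
qed

end
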